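(* Let $\alpha>0$ and $\beta,\gamma,\delta\ge 0$ be real numbers, let $\lambda\in\mathbb{R}$, let $t>0$, and let $$G=\begin{bmatrix}0&1\\-\alpha\lambda-\delta&-\beta\lambda-\gamma\end{bmatrix}.$$ Assume $(\beta\lambda+\gamma)^2<4(\alpha\lambda+\delta)$ and set $$m=-\tfrac12(\beta\lambda+\gamma),\qquad n=\tfrac12\sqrt{4(\alpha\lambda+\delta)-(\beta\lambda+\gamma)^2}.$$ Then the matrix $tG$ has two conjugate complex eigenvalues $z_1$ and $z_2$ with $z_1=tm+\mathrm{i}\,tn$, and for every integer $k\ge0$, $$\varphi_k(tG)=\frac{i_k}{n}\begin{bmatrix}-m&1\\-n^2-m^2&m\end{bmatrix}+r_kI,$$ where the real coefficients $i_k$ and $r_k$, depending on $(t,m,n)$, are given recursively by $$i_0=\mathrm{e}^{tm}\sin(tn),\qquad r_0=\mathrm{e}^{tm}\cos(tn),$$ and, for $k\ge1$, $$i_k=\frac{1}{t(m^2+n^2)}\left(m\,i_{k-1}-n\left(r_{k-1}-\frac{1}{(k-1)!}\right)\right),$$ $$r_k=\frac{1}{t(m^2+n^2)}\left(n\,i_{k-1}+m\left(r_{k-1}-\frac{1}{(k-1)!}\right)\right).$$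
   Context: $I$ denotes the $2\times2$ identity matrix and $\mathrm{i}$ the imaginary unit (distinct from the real coefficients $i_k$). The entire functions $\varphi_k$ are $\varphi_0(z)=\mathrm{e}^z$ and, for $k\ge1$, $$\varphi_k(z)=\int_0^1\mathrm{e}^{(1-\theta)z}\frac{\theta^{k-1}}{(k-1)!}\,d\theta;$$ equivalently $\varphi_k(z)=\sum_{j=0}^\infty\frac{z^j}{(j+k)!}$ for all $k\ge0$. For a square matrix $M$, $\varphi_k(M)=\sum_{j=0}^\infty\frac{M^j}{(j+k)!}$. *)

theory Defs
  imports "HOL-Analysis.Analysis"
begin

(* The operations * and ^ act entrywise on the type of vectors of vectors,
   so powers for the matrix product ** are introduced here. *)
primrec matrix_power :: "'a::semiring_1 ^ 'n ^ 'n \<Rightarrow> nat \<Rightarrow> 'a ^ 'n ^ 'n" where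
  "matrix_power M 0 = mat 1"
| "matrix_power M (Suc j) = M ** matrix_power M j"

definition phi_matrix :: "nat \<Rightarrow> real ^ 'n ^ 'n \<Rightarrow> real ^ 'n ^ 'n" where
  "phi_matrix k M = (\<Sum>j. (1 / fact (j + k)) *\<^sub>R matrix_power M j)"

definition complex_eigenvalue :: "real ^ 'n ^ 'n \<Rightarrow> complex \<Rightarrow> bool" where
  "complex_eigenvalue M z \<longleftrightarrow> (\<exists>v. v \<noteq> 0 \<and> map_matrix complex_of_real M *v v = z *s v)"

fun i_coeff :: "real \<Rightarrow> real \<Rightarrow> real \<Rightarrow> nat \<Rightarrow> real"
  and r_coeff :: "real \<Rightarrow> real \<Rightarrow> real \<Rightarrow> nat \<Rightarrow> real" where
  "i_coeff t m n 0 = exp (t * m) * sin (t * n)"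
| "r_coeff t m n 0 = exp (t * m) * cos (t * n)"
| "i_coeff t m n (Suc k) =
     1 / (t * (m\<^sup>2 + n\<^sup>2)) * (m * i_coeff t m n k - n * (r_coeff t m n k - 1 / fact k))"
| "r_coeff t m n (Suc k) =
     1 / (t * (m\<^sup>2 + n\<^sup>2)) * (n * i_coeff t m n k + m * (r_coeff t m n k - 1 / fact k))"

end

theory Submission
  imports Defs
begin

text \<open>
  Writing \<open>tG = (tm) I + (tn) J\<close> with \<open>J\<^sup>2 = -I\<close>, the map \<open>z \<mapsto> Re z I + Im z J\<close> is a
  continuous ring homomorphism from the complex numbers that sends \<open>w = tm + i tn\<close> to \<open>tG\<close>. Hence
  \<open>\<phi>\<^sub>k(tG)\<close> is the image of the complex number \<open>\<phi>\<^sub>k(w)\<close>, and the recursion for the coefficients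
  is the real and imaginary part of \<open>w \<phi>\<^sub>k\<^sub>+\<^sub>1(w) = \<phi>\<^sub>k(w) - 1/k!\<close>.
\<close>

definition complex_embed :: "real ^ 'n ^ 'n \<Rightarrow> complex \<Rightarrow> real ^ 'n ^ 'n" where
  "complex_embed J z = Re z *\<^sub>R mat 1 + Im z *\<^sub>R J"

lemma bounded_linear_complex_embed: "bounded_linear (complex_embed J)"
  unfolding linear_conv_bounded_linear[symmetric]
  by (rule linearI) (simp_all add: complex_embed_def algebra_simps)

lemma matrix_mult_scaleR:
  fixes A :: "real ^ 'n ^ 'm"
  shows "(c *\<^sub>R A) ** B = c *\<^sub>R (A ** B)" "A ** (c *\<^sub>R B) = c *\<^sub>R (A ** B)"
  by (simp_all add: matrix_scalar_ac flip: scalar_matrix_assoc)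

lemma matrix_add_rdistrib: "(A + B) ** C = A ** C + B ** C"
  by (vector matrix_matrix_mult_def sum.distrib[symmetric] field_simps)

text \<open>Expanding the right side leaves one term with \<open>J ** J\<close>; the hypothesis
  plays the part of i^2 = -1 and makes it the real term -(Im z)(Im w).\<close>

lemma complex_embed_mult:
  assumes "J ** J = - mat 1"
  shows "complex_embed J (z * w) = complex_embed J z ** complex_embed J w"
  by (simp add: complex_embed_def matrix_add_ldistrib matrix_add_rdistrib assms
      matrix_mult_scaleR algebra_simps)

lemma complex_embed_power:
  assumes "J ** J = - mat 1"
  shows "complex_embed J (z ^ j) = matrix_power (complex_embed J z) j"
proof (induction j)
  case 0
  show ?case by (simp add: complex_embed_def)
next
  case (Suc j)
  then show ?case by (simp add: complex_embed_mult[OF assms])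
qed

definition phi_complex :: "nat \<Rightarrow> complex \<Rightarrow> complex" where
  "phi_complex k z = (\<Sum>j. (1 / fact (j + k)) *\<^sub>R z ^ j)"

text \<open>The exponential series dominates termwise, because j! \<le> (j+k)!.\<close>

lemma summable_phi_complex: "summable (\<lambda>j. (1 / fact (j + k)) *\<^sub>R (z::complex) ^ j)"
proof (rule summable_comparison_test')
  show "summable (\<lambda>j. norm (z ^ j /\<^sub>R fact j))"
    by (rule summable_norm_exp)
  show "norm ((1 / fact (j + k)) *\<^sub>R z ^ j) \<le> norm (z ^ j /\<^sub>R fact j)" for j
    by (auto simp: norm_power divide_inverse intro!: mult_right_mono le_imp_inverse_le fact_mono)
qed

lemma phi_complex_0: "phi_complex 0 z = exp z"
  by (simp add: phi_complex_def exp_def divide_inverse)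

text \<open>Multiplication by \<open>z\<close> shifts the index: term j on the left is term j+1 of
  the series of \<open>phi_complex k z\<close>, so only the head 1/k! is missing.\<close>

lemma phi_complex_Suc: "z * phi_complex (Suc k) z = phi_complex k z - 1 / fact k"
proof -
  have "z * phi_complex (Suc k) z = (\<Sum>j. (1 / fact (Suc j + k)) *\<^sub>R z ^ Suc j)"
    unfolding phi_complex_def
    by (subst suminf_mult[OF summable_phi_complex, symmetric]) (simp add: algebra_simps)
  also have "\<dots> = phi_complex k z - (1 / fact k) *\<^sub>R 1"
    unfolding phi_complex_def
    by (subst suminf_split_head[OF summable_phi_complex]) simp
  finally show ?thesis by (simp add: scaleR_conv_of_real)
qed

text \<open>A bounded linear map passes through a convergent series, and this one also preserves
  powers. Convergence is thus needed only for the complex series.\<close>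

lemma phi_matrix_complex_embed:
  assumes "J ** J = - mat 1"
  shows "phi_matrix k (complex_embed J z) = complex_embed J (phi_complex k z)"
proof -
  interpret bounded_linear "complex_embed J" by (rule bounded_linear_complex_embed)
  show ?thesis
    unfolding phi_matrix_def phi_complex_def suminf[OF summable_phi_complex]
    by (simp add: scaleR complex_embed_power[OF assms])
qed

lemma phi_complex_eq_coeff:
  assumes "t \<noteq> 0" "n \<noteq> 0"
  shows "phi_complex k (Complex (t * m) (t * n)) = Complex (r_coeff t m n k) (i_coeff t m n k)"
proof (induction k)
  case 0
  show ?case by (simp add: phi_complex_0 complex_eq_iff Re_exp Im_exp)
next
  case (Suc k)
  define w where "w = Complex (t * m) (t * n)"
  define D where "D = t * (m\<^sup>2 + n\<^sup>2)"
  have w: "w \<noteq> 0" using assms by (simp add: w_def complex_eq_iff)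
  have D: "D \<noteq> 0" using assms by (simp add: D_def)
  \<comment> \<open>This is the conjugate of \<open>w\<close> over its squared modulus t^2 (m^2 +
    n^2), with one factor \<open>t\<close> cancelled; hence the prefactor 1/\<open>D\<close> of the
    recursion.\<close>
  have inv: "inverse w = Complex (m / D) (- n / D)"
  proof (rule inverse_unique)
    have "t * m * (m / D) - t * n * (- n / D) = D / D"
      unfolding D_def by (simp add: power2_eq_square algebra_simps flip: add_divide_distrib)
    then show "w * Complex (m / D) (- n / D) = 1"
      using D by (simp add: w_def complex_eq_iff)
  qed
  have "phi_complex (Suc k) w = inverse w * (w * phi_complex (Suc k) w)"
    using w by simp
  also have "\<dots> = inverse w * (phi_complex k w - 1 / fact k)"
    by (simp only: phi_complex_Suc)
  also have "1 / fact k = Complex (1 / fact k) 0"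
    unfolding complex_of_real_def[symmetric] by simp
  also have "phi_complex k w = Complex (r_coeff t m n k) (i_coeff t m n k)"
    unfolding w_def by (rule Suc.IH)
  finally have "phi_complex (Suc k) w = Complex
      (1 / D * (n * i_coeff t m n k + m * (r_coeff t m n k - 1 / fact k)))
      (1 / D * (m * i_coeff t m n k - n * (r_coeff t m n k - 1 / fact k)))"
    unfolding inv by (simp add: complex_eq_iff add_divide_distrib diff_divide_distrib)
  then show ?case
    by (simp only: w_def D_def r_coeff.simps i_coeff.simps)
qed

text \<open>The quadratic is the characteristic polynomial of \<open>t\<close> times a companion
  matrix. The first row forces every eigenvector to be a multiple of (t, z); on that vector the
  second row is the quadratic equation.\<close>

lemma complex_eigenvalue_companion:
  fixes t p q :: real
  assumes "t \<noteq> 0"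
  shows "complex_eigenvalue (t *\<^sub>R (vector [vector [0, 1], vector [- q, p]] :: real ^ 2 ^ 2)) z
    \<longleftrightarrow> z\<^sup>2 - of_real (t * p) * z + of_real (t\<^sup>2 * q) = 0" (is "?E \<longleftrightarrow> ?P = 0")
proof -
  have mv: "map_matrix complex_of_real
        (t *\<^sub>R (vector [vector [0, 1], vector [- q, p]] :: real ^ 2 ^ 2)) *v v = z *s v
      \<longleftrightarrow> t * v $ 2 = z * v $ 1 \<and> - (t * q) * v $ 1 + t * p * v $ 2 = z * v $ 2" for v :: "complex ^ 2"
    by (simp add: vec_eq_iff forall_2 matrix_vector_mult_def map_matrix_def sum_2)
  show ?thesis
  proof
    assume ?E
    then obtain v :: "complex ^ 2" where v: "v \<noteq> 0" and e1: "t * v $ 2 = z * v $ 1"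
      and e2: "- (t * q) * v $ 1 + t * p * v $ 2 = z * v $ 2"
      unfolding complex_eigenvalue_def mv by blast
    have "v $ 1 \<noteq> 0"
      using v e1 assms by (auto simp: vec_eq_iff forall_2)
    moreover have "?P * v $ 1 = 0"
    proof -
      \<comment> \<open>The factors \<open>z * v $ 1\<close> are isolated so that the first row can
        replace them by \<open>t * v $ 2\<close>.\<close>
      have "?P * v $ 1 = z * (z * v $ 1) - of_real p * (t * (z * v $ 1)) + of_real (t\<^sup>2 * q) * v $ 1"
        by (simp add: algebra_simps power2_eq_square)
      also have "\<dots> = t * (z * v $ 2 - (- (t * q) * v $ 1 + t * p * v $ 2))"
        unfolding e1[symmetric] by (simp add: algebra_simps power2_eq_square)
      finally show ?thesis by (simp only: e2) simp
    qed
    ultimately show "?P = 0" by simp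
  next
    assume P: "?P = 0"
    let ?v = "vector [of_real t, z] :: complex ^ 2"
    have "?v \<noteq> 0" using assms by (auto simp: vec_eq_iff forall_2)
    moreover have "- (t * q) * of_real t + t * p * z = z * z"
      using P by (simp add: algebra_simps power2_eq_square)
    ultimately show ?E
      unfolding complex_eigenvalue_def mv by (intro exI[of _ ?v]) simp
  qed
qed

theorem lemma3p7:
  fixes \<alpha> \<beta> \<gamma> \<delta> lam t m n :: real
    and G :: "real ^ 2 ^ 2"
  assumes "\<alpha> > 0" and "\<beta> \<ge> 0" and "\<gamma> \<ge> 0" and "\<delta> \<ge> 0" and "t > 0"
    and "G = vector [vector [0, 1],
                     vector [- \<alpha> * lam - \<delta>, - \<beta> * lam - \<gamma>]]"
    and "(\<beta> * lam + \<gamma>)\<^sup>2 < 4 * (\<alpha> * lam + \<delta>)"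
    and "m = - (1 / 2) * (\<beta> * lam + \<gamma>)"
    and "n = 1 / 2 * sqrt (4 * (\<alpha> * lam + \<delta>) - (\<beta> * lam + \<gamma>)\<^sup>2)"
  shows "(\<exists>z\<^sub>1 z\<^sub>2. z\<^sub>1 = complex_of_real (t * m) + \<i> * complex_of_real (t * n) \<and>
            z\<^sub>2 = cnj z\<^sub>1 \<and> z\<^sub>1 \<noteq> z\<^sub>2 \<and>
            {z. complex_eigenvalue (t *\<^sub>R G) z} = {z\<^sub>1, z\<^sub>2}) \<and>
         (\<forall>k. phi_matrix k (t *\<^sub>R G) =
            (i_coeff t m n k / n) *\<^sub>R
              (vector [vector [- m, 1], vector [- n\<^sup>2 - m\<^sup>2, m]] :: real ^ 2 ^ 2)
            + r_coeff t m n k *\<^sub>R mat 1)"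
proof -
  have n_pos: "n > 0"
    unfolding assms(9) using assms(7) by simp
  have n_sq: "n\<^sup>2 = (\<alpha> * lam + \<delta>) - m\<^sup>2"
  proof -
    have "n\<^sup>2 = (1 / 2)\<^sup>2 * (4 * (\<alpha> * lam + \<delta>) - (\<beta> * lam + \<gamma>)\<^sup>2)"
      unfolding assms(9) power_mult_distrib using assms(7) by simp
    moreover have "m\<^sup>2 = (1 / 2)\<^sup>2 * (\<beta> * lam + \<gamma>)\<^sup>2"
      unfolding assms(8) by (simp add: power_mult_distrib power_divide)
    ultimately show ?thesis
      by (simp add: power_divide)
  qed
  \<comment> \<open>The trace of \<open>G\<close> is 2m and its determinant is m^2 + n^2.\<close>
  have G: "G = vector [vector [0, 1], vector [- (m\<^sup>2 + n\<^sup>2), 2 * m]]"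
    unfolding n_sq assms(6) assms(8) by (simp add: vec_eq_iff forall_2 field_simps)
  let ?z = "Complex (t * m) (t * n)"
  \<comment> \<open>\<open>K\<close> is the trace-free part G - m I. Its square is -n^2 I, so
    division by \<open>n\<close> gives the imaginary unit \<open>J\<close>.\<close>
  define K :: "real ^ 2 ^ 2" where "K = vector [vector [- m, 1], vector [- n\<^sup>2 - m\<^sup>2, m]]"
  define J where "J = (1 / n) *\<^sub>R K"
  have "K ** K = - (n\<^sup>2 *\<^sub>R mat 1)"
    by (simp add: K_def vec_eq_iff forall_2 matrix_matrix_mult_def sum_2 mat_def
        power2_eq_square algebra_simps)
  then have JJ: "J ** J = - mat 1"
    using n_pos by (simp add: J_def matrix_mult_scaleR power2_eq_square)
  have tG: "t *\<^sub>R G = complex_embed J ?z"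
    using n_pos by (simp add: complex_embed_def J_def K_def G vec_eq_iff forall_2 mat_def
        algebra_simps)
  have phi: "phi_matrix k (t *\<^sub>R G) = (i_coeff t m n k / n) *\<^sub>R K + r_coeff t m n k *\<^sub>R mat 1" for k
    using n_pos \<open>t > 0\<close>
    by (simp add: tG phi_matrix_complex_embed[OF JJ] phi_complex_eq_coeff)
      (simp add: complex_embed_def J_def)
  have "complex_eigenvalue (t *\<^sub>R G) z \<longleftrightarrow> z = ?z \<or> z = cnj ?z" for z
  proof -
    \<comment> \<open>Vieta: \<open>?z\<close> and its conjugate have sum 2tm and product t^2 (m^2 +
      n^2).\<close>
    have "z\<^sup>2 - of_real (t * (2 * m)) * z + of_real (t\<^sup>2 * (m\<^sup>2 + n\<^sup>2)) = (z - ?z) * (z - cnj ?z)"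
      by (simp add: complex_eq_iff power2_eq_square algebra_simps)
    then show ?thesis
      unfolding G complex_eigenvalue_companion[OF less_imp_neq[OF \<open>t > 0\<close>, symmetric]] by simp
  qed
  then have "{z. complex_eigenvalue (t *\<^sub>R G) z} = {?z, cnj ?z}"
    by blast
  moreover have "?z \<noteq> cnj ?z"
    using n_pos \<open>t > 0\<close> by (simp add: complex_eq_iff)
  moreover have "?z = complex_of_real (t * m) + \<i> * complex_of_real (t * n)"
    by (simp add: complex_eq_iff)
  ultimately show ?thesis
    using phi unfolding K_def by blast
qed

end
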